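(* The function $A\mapsto\mu(A)$ is lower semicontinuous on the metric space $(\mathbb{R}_+^{\infty\times\infty},d)$.
   Context: $\mathbb{R}_+^{\infty\times\infty}$ is the set of infinite matrices $A=(a_{ij})_{i,j\in\mathbb{N}}$ with non-negative real entries and $\|A\|:=\sup\{a_{ij}:i,j\in\mathbb{N}\}<\infty$, with the metric $d(A,B)=\|A-B\|=\sup\{|a_{ij}-b_{ij}|:i,j\in\mathbb{N}\}$. For $i_0,\dots,i_k\in\mathbb{N}$ put $A(i_k,\dots,i_0)=\prod_{t=0}^{k-1}a_{i_{t+1}i_t}$, and define $\mu(A)=\sup\{A(i_1,i_k,\dots,i_2,i_1)^{1/k}:k\in\mathbb{N},\ i_1,\dots,i_k\in\mathbb{N}\}$. *)

theory Defs
  imports "HOL-Analysis.Analysis"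
begin

text \<open>
  Infinite matrices with non-negative, uniformly bounded real entries. The index set is the
  type \<open>nat\<close>; whether indices start at 0 or 1 is immaterial.
\<close>

typedef nonneg_matrix =
  "{a :: nat \<Rightarrow> nat \<Rightarrow> real. (\<forall>i j. 0 \<le> a i j) \<and> bdd_above {a i j | i j. True}}"
  morphisms entry Nonneg_Matrix
  by (rule exI[of _ "\<lambda>_ _. 0"]) auto

lemma entry_nonneg: "0 \<le> entry A i j"
  using entry[of A] by auto

lemma entry_bounded: obtains b where "0 \<le> b" "\<And>i j. entry A i j \<le> b"
proof -
  from entry[of A] obtain b where "\<And>i j. entry A i j \<le> b"
    unfolding bdd_above_def by blast
  with entry_nonneg[of A 0 0] show thesis
    by (meson order_trans that)
qed

instantiation nonneg_matrix :: metric_space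
begin

definition dist_nonneg_matrix :: "nonneg_matrix \<Rightarrow> nonneg_matrix \<Rightarrow> real" where
  "dist_nonneg_matrix A B = Sup {\<bar>entry A i j - entry B i j\<bar> | i j. True}"

definition uniformity_nonneg_matrix :: "(nonneg_matrix \<times> nonneg_matrix) filter" where
  "uniformity_nonneg_matrix = (INF e\<in>{0 <..}. principal {(A, B). dist A B < e})"

definition open_nonneg_matrix :: "nonneg_matrix set \<Rightarrow> bool" where
  "open_nonneg_matrix U = (\<forall>A\<in>U. \<forall>\<^sub>F (A', B) in uniformity. A' = A \<longrightarrow> B \<in> U)"

lemma entry_diff_le_dist: "\<bar>entry A i j - entry B i j\<bar> \<le> dist A B"
  unfolding dist_nonneg_matrix_def
proof (rule cSup_upper)
  obtain a b where "\<And>i j. entry A i j \<le> a" "\<And>i j. entry B i j \<le> b"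
    by (metis entry_bounded)
  moreover have "0 \<le> entry A i j" "0 \<le> entry B i j" for i j
    by (rule entry_nonneg)+
  ultimately have "\<bar>entry A i j - entry B i j\<bar> \<le> a + b" for i j
    by (smt (verit))
  then show "bdd_above {\<bar>entry A i j - entry B i j\<bar> | i j. True}"
    by (auto simp: bdd_above_def)
qed auto

lemma dist_le_entry_diff:
  assumes "\<And>i j. \<bar>entry A i j - entry B i j\<bar> \<le> c"
  shows "dist A B \<le> c"
  unfolding dist_nonneg_matrix_def using assms by (intro cSup_least) auto

instance
proof
  fix A B C :: nonneg_matrix
  show "dist A B = 0 \<longleftrightarrow> A = B"
  proof
    assume "dist A B = 0"
    then have "entry A i j = entry B i j" for i j
      using entry_diff_le_dist[of A i j B] by simp
    then have "entry A = entry B"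
      by blast
    then show "A = B"
      by (simp add: entry_inject)
  qed (simp add: dist_nonneg_matrix_def)
  show "dist A B \<le> dist A C + dist B C"
  proof (rule dist_le_entry_diff)
    fix i j
    show "\<bar>entry A i j - entry B i j\<bar> \<le> dist A C + dist B C"
      using entry_diff_le_dist[of A i j C] entry_diff_le_dist[of B i j C] by linarith
  qed
qed (rule uniformity_nonneg_matrix_def open_nonneg_matrix_def)+

end

text \<open>
  \<open>path_product A k i\<close> is \<open>A(i_k, \<dots>, i_0)\<close>; only the values \<open>i 0, \<dots>, i k\<close> are used.
\<close>

definition path_product :: "nonneg_matrix \<Rightarrow> nat \<Rightarrow> (nat \<Rightarrow> nat) \<Rightarrow> real" where
  "path_product A k i = (\<Prod>t<k. entry A (i (Suc t)) (i t))"

text \<open>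
  The cycle \<open>(i_1, i_k, \<dots>, i_2, i_1)\<close> is written here as \<open>(i k, \<dots>, i 1, i 0)\<close> with
  \<open>i k = i 0\<close>, i.e. with indices shifted by one. It has \<open>k \<ge> 1\<close> edges.
\<close>

definition mu :: "nonneg_matrix \<Rightarrow> real" where
  "mu A = Sup {root k (path_product A k i) | k i. 1 \<le> k \<and> i k = i 0}"

text \<open>The supremum defining \<^const>\<open>mu\<close> is over a non-empty bounded set of reals.\<close>

lemma mu_set_nonempty: "{root k (path_product A k i) | k i. 1 \<le> k \<and> i k = i 0} \<noteq> {}"
proof -
  have "root 1 (path_product A 1 (\<lambda>_. 0))
      \<in> {root k (path_product A k i) | k i. 1 \<le> k \<and> i k = i 0}"
    by blast
  then show ?thesis
    by blast
qed

lemma mu_set_bdd_above: "bdd_above {root k (path_product A k i) | k i. 1 \<le> k \<and> i k = i 0}"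
proof -
  obtain b where b: "0 \<le> b" "\<And>i j. entry A i j \<le> b"
    by (rule entry_bounded[of A]) blast
  have "root k (path_product A k i) \<le> b" if "1 \<le> k" for k i
  proof -
    have "path_product A k i \<le> (\<Prod>t<k. b)"
      unfolding path_product_def by (rule prod_mono) (simp add: b entry_nonneg)
    then have "root k (path_product A k i) \<le> root k (b ^ k)"
      using that by simp
    also have "\<dots> = b"
      using that b by (simp add: real_root_power_cancel)
    finally show ?thesis .
  qed
  then show ?thesis
    by (intro bdd_aboveI[of _ b]) auto
qed

definition lower_semicontinuous ::
    "('a::topological_space \<Rightarrow> 'b::linorder) \<Rightarrow> bool" where
  "lower_semicontinuous f \<longleftrightarrow> (\<forall>x. \<forall>c < f x. \<forall>\<^sub>F y in nhds x. c < f y)"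

end

theory Submission
  imports Defs
begin

text \<open>A pointwise supremum of continuous functions is lower semicontinuous. For a fixed cycle,
  the root of its product involves finitely many entries, so it is continuous in the matrix
  (\<open>tendsto_root_path_product\<close>). A cycle whose value at \<open>A\<close> exceeds
  \<open>c\<close> (\<open>less_muE\<close>) therefore still exceeds \<open>c\<close> near
  \<open>A\<close>, and \<open>mu\<close> dominates that value
  (\<open>root_path_product_le_mu\<close>).\<close>

lemma tendsto_entry: "((\<lambda>B. entry B i j) \<longlongrightarrow> entry A i j) (nhds A)"
proof (rule tendstoI)
  fix e :: real
  assume "0 < e"
  then have "\<forall>\<^sub>F B in nhds A. dist B A < e"
    by (auto simp: eventually_nhds_metric)
  then show "\<forall>\<^sub>F B in nhds A. dist (entry B i j) (entry A i j) < e"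
    by eventually_elim (metis dist_real_def entry_diff_le_dist order_le_less_trans)
qed

lemma tendsto_root_path_product:
  "((\<lambda>B. root k (path_product B k i)) \<longlongrightarrow> root k (path_product A k i)) (nhds A)"
  unfolding path_product_def
  by (intro tendsto_real_root tendsto_prod tendsto_entry)

lemma root_path_product_le_mu:
  assumes "1 \<le> k" "i k = i 0"
  shows "root k (path_product A k i) \<le> mu A"
  unfolding mu_def using assms by (intro cSup_upper mu_set_bdd_above) blast

text \<open>\<open>Sup\<close> on the reals is a true supremum here, the set being non-empty and
  bounded above.\<close>

lemma less_muE:
  assumes "c < mu A"
  obtains k i where "1 \<le> k" "i k = i 0" "c < root k (path_product A k i)"
  using assms unfolding mu_def less_cSup_iff[OF mu_set_nonempty mu_set_bdd_above] by blast

theorem proposition5p6: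
  shows "lower_semicontinuous (mu :: nonneg_matrix \<Rightarrow> real)"
  unfolding lower_semicontinuous_def
proof (intro allI impI)
  fix A c
  assume "c < mu A"
  then obtain k i where cycle: "1 \<le> k" "i k = i 0" and "c < root k (path_product A k i)"
    by (rule less_muE)
  then have "\<forall>\<^sub>F B in nhds A. c < root k (path_product B k i)"
    using order_tendstoD(1)[OF tendsto_root_path_product] by blast
  then show "\<forall>\<^sub>F B in nhds A. c < mu B"
    \<comment> \<open>The cycle found for \<open>A\<close> also competes for \<open>mu B\<close>:
      which cycles are admissible does not depend on the matrix.\<close>
    by eventually_elim (rule less_le_trans[OF _ root_path_product_le_mu[of k i, OF cycle]])
qed

end
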